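(* Let $0<\nu\le 1$, let the defender be at $\mathbf z_D=[0,\phi_D,1]$ with $\phi_D\in[0,\pi/2]$ and the intruder at $\mathbf z_A=[\psi,0,r]$ with $r>1$. Then the payoff $p(\mathbf z_D,\mathbf z_A,\mathbf z_B)=\tau_D(\mathbf z_D,\mathbf z_B)-\tau_A(\mathbf z_A,\mathbf z_B)$, regarded as a function of the breaching point $\mathbf z_B$, is maximized if the intruder selects the breaching point $\mathbf z_B=[\theta^*,0,1]$ (breaching angle $\theta^*$) whose approach angle $\beta^*$ is $$\beta^*=\cos^{-1}\left(\nu\,\frac{\cos\phi_D\,\sin\theta^*}{\sqrt{1-\cos^2\phi_D\cos^2\theta^*}}\right).$$
   Context: The target is a hemisphere of unit radius centered at the origin $O$ and standing on a ground plane; its boundary on the ground is the unit circle (the perimeter). The defender $D$ moves on the hemisphere with maximum speed $1$; the intruder $A$ moves on the ground plane outside the unit circle with maximum speed $\nu\in(0,1]$. Positions are written in spherical coordinates [azimuth, elevation, radius], with azimuth measured relative to the defender: $\mathbf z_D=[0,\phi_D,1]$, $\mathbf z_A=[\psi,0,r]$, $r>1$. A breaching point is a point $\mathbf z_B=[\theta,0,1]$ on the perimeter that the intruder can reach along a straight segment meeting the closed unit disk only at $\mathbf z_B$, i.e. $|\theta-\psi|\le\cos^{-1}(1/r)$ (angles modulo $2\pi$); $\theta$ is the breaching angle. The target times are the travel times along shortest paths at maximum speed: $\tau_D(\mathbf z_D,\mathbf z_B)=\cos^{-1}(\cos\phi_D\cos\theta)$ (great-circle geodesic) and $\tau_A(\mathbf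 z_A,\mathbf z_B)=\frac1\nu\sqrt{r^2+1-2r\cos(\theta-\psi)}$ (straight segment). The approach angle $\beta\in[0,\pi]$ of a breaching point is the angle between $\mathbf z_A-\mathbf z_B$ and the tangent line to the unit circle at $\mathbf z_B$, directed toward decreasing azimuth, so that $\cos\beta=r\sin(\theta-\psi)/\|\mathbf z_A-\mathbf z_B\|$.
   Formalization: Some points satisfying the angle equation are local minima, so it is proved that a maximizer exists, every maximizer satisfies it (except φ_D=0, θ*=π, where the formula is 0/0), and a solution with the largest payoff among solutions maximizes p. *)

theory Defs
  imports "HOL-Analysis.Analysis"
begin

text \<open>
  The ground plane is the plane \<open>x $ 3 = 0\<close> of \<open>real ^ 3\<close>. The map below takes the spherical coordinates
  [azimuth, elevation, radius] to Cartesian ones.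
\<close>

definition spherical :: "real \<Rightarrow> real \<Rightarrow> real \<Rightarrow> real ^ 3" where
  "spherical \<theta> \<phi> \<rho> = vector [\<rho> * cos \<phi> * cos \<theta>, \<rho> * cos \<phi> * sin \<theta>, \<rho> * sin \<phi>]"

definition perimeter :: "(real ^ 3) set" where
  "perimeter = {spherical \<theta> 0 1 |\<theta>. True}"

definition ground_disk :: "(real ^ 3) set" where
  "ground_disk = {x. x $ 3 = 0 \<and> norm x \<le> 1}"

definition breaching_points :: "real ^ 3 \<Rightarrow> (real ^ 3) set" where
  "breaching_points zA = {zB \<in> perimeter. closed_segment zA zB \<inter> ground_disk = {zB}}"

text \<open>
  For points of the unit sphere, \<open>arccos (x \<bullet> y)\<close> is the great-circle distance; the defender has speed 1.
\<close>

definition defender_time :: "real ^ 3 \<Rightarrow> real ^ 3 \<Rightarrow> real" where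
  "defender_time zD zB = arccos (zD \<bullet> zB)"

definition intruder_time :: "real \<Rightarrow> real ^ 3 \<Rightarrow> real ^ 3 \<Rightarrow> real" where
  "intruder_time \<nu> zA zB = norm (zA - zB) / \<nu>"

definition payoff :: "real \<Rightarrow> real ^ 3 \<Rightarrow> real ^ 3 \<Rightarrow> real ^ 3 \<Rightarrow> real" where
  "payoff \<nu> zD zA zB = defender_time zD zB - intruder_time \<nu> zA zB"

definition vec_angle :: "real ^ 3 \<Rightarrow> real ^ 3 \<Rightarrow> real" where
  "vec_angle u v = arccos ((u \<bullet> v) / (norm u * norm v))"

text \<open>Unit tangent to the perimeter at \<open>z\<close> in the direction of decreasing azimuth.\<close>

definition clockwise_tangent :: "real ^ 3 \<Rightarrow> real ^ 3" where
  "clockwise_tangent z = vector [z $ 2, - z $ 1, 0]"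

definition approach_angle :: "real ^ 3 \<Rightarrow> real ^ 3 \<Rightarrow> real" where
  "approach_angle zA zB = vec_angle (zA - zB) (clockwise_tangent zB)"

text \<open>
  The first conjunct keeps the fraction from being read as \<open>x / 0 = 0\<close>: for \<open>0 \<le> \<phi> \<le> pi / 2\<close> the
  denominator vanishes exactly when \<open>\<phi> = 0\<close> and \<open>\<theta>\<close> is a multiple of \<open>pi\<close>.
\<close>

definition optimal_approach :: "real \<Rightarrow> real \<Rightarrow> real ^ 3 \<Rightarrow> real \<Rightarrow> bool" where
  "optimal_approach \<nu> \<phi> zA \<theta> \<longleftrightarrow>
     sqrt (1 - (cos \<phi>)\<^sup>2 * (cos \<theta>)\<^sup>2) \<noteq> 0 \<and>
     approach_angle zA (spherical \<theta> 0 1) =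
       arccos (\<nu> * (cos \<phi> * sin \<theta> / sqrt (1 - (cos \<phi>)\<^sup>2 * (cos \<theta>)\<^sup>2)))"

lemma defender_time_spherical:
  "defender_time (spherical 0 \<phi> 1) (spherical \<theta> 0 1) = arccos (cos \<phi> * cos \<theta>)"
  by (simp add: defender_time_def spherical_def inner_vec_def sum_3)

lemma norm_intruder_breach:
  "norm (spherical \<psi> 0 r - spherical \<theta> 0 1) = sqrt (r\<^sup>2 + 1 - 2 * r * cos (\<theta> - \<psi>))"
proof -
  have "(r * cos \<psi> - cos \<theta>)\<^sup>2 + (r * sin \<psi> - sin \<theta>)\<^sup>2
      = r\<^sup>2 * ((sin \<psi>)\<^sup>2 + (cos \<psi>)\<^sup>2) + ((sin \<theta>)\<^sup>2 + (cos \<theta>)\<^sup>2) - 2 * r * cos (\<theta> - \<psi>)"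
    unfolding cos_diff by algebra
  also have "\<dots> = r\<^sup>2 + 1 - 2 * r * cos (\<theta> - \<psi>)"
    by (simp only: sin_cos_squared_add)
  finally show ?thesis
    by (simp add: spherical_def norm_eq_sqrt_inner inner_vec_def sum_3 power2_eq_square)
qed

lemma intruder_time_spherical:
  "intruder_time \<nu> (spherical \<psi> 0 r) (spherical \<theta> 0 1)
     = 1 / \<nu> * sqrt (r\<^sup>2 + 1 - 2 * r * cos (\<theta> - \<psi>))"
  by (simp add: intruder_time_def norm_intruder_breach)

lemma norm_clockwise_tangent: "norm (clockwise_tangent (spherical \<theta> 0 1)) = 1"
  by (simp add: clockwise_tangent_def spherical_def norm_eq_sqrt_inner inner_vec_def sum_3
      flip: power2_eq_square)

lemma cos_approach_angle:
  "cos (approach_angle (spherical \<psi> 0 r) (spherical \<theta> 0 1))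
     = r * sin (\<theta> - \<psi>) / norm (spherical \<psi> 0 r - spherical \<theta> 0 1)"
proof -
  let ?u = "spherical \<psi> 0 r - spherical \<theta> 0 1" and ?t = "clockwise_tangent (spherical \<theta> 0 1)"
  have inner: "?u \<bullet> ?t = r * sin (\<theta> - \<psi>)"
    by (simp add: clockwise_tangent_def spherical_def inner_vec_def sum_3 sin_diff algebra_simps)
  have "\<bar>?u \<bullet> ?t\<bar> \<le> norm ?u"
    using Cauchy_Schwarz_ineq2[of ?u ?t] by (simp add: norm_clockwise_tangent)
  then have "\<bar>?u \<bullet> ?t / norm ?u\<bar> \<le> 1"
    by (simp add: divide_le_eq_1)
  then show ?thesis
    by (simp add: approach_angle_def vec_angle_def norm_clockwise_tangent inner cos_arccos_abs)
qed

lemma breaching_iff_cos: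
  assumes "r > 1"
  shows "spherical \<theta> 0 1 \<in> breaching_points (spherical \<psi> 0 r) \<longleftrightarrow> 1 \<le> r * cos (\<theta> - \<psi>)"
proof -
  let ?A = "spherical \<psi> 0 r" and ?B = "spherical \<theta> 0 1"
  define m where "m = r * cos (\<theta> - \<psi>) - 1"
  define d where "d = (norm (?A - ?B))\<^sup>2"
  have nA: "norm ?A = r" and nB: "norm ?B = 1"
    using assms
    by (simp_all add: spherical_def norm_eq_sqrt_inner inner_vec_def sum_3
        power_mult_distrib flip: power2_eq_square distrib_left)
  have BB: "?B \<bullet> ?B = 1"
    using nB by (simp add: norm_eq_1)
  have m: "?B \<bullet> (?A - ?B) = m"
    using BB unfolding inner_diff_right
    by (simp add: m_def) (simp add: spherical_def inner_vec_def sum_3 cos_diff algebra_simps)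
  have "?A \<noteq> ?B"
    using nA nB assms by auto
  then have d: "d > 0"
    by (simp add: d_def)
  define P where "P t = ?B + t *\<^sub>R (?A - ?B)" for t
  have nP: "(norm (P t))\<^sup>2 = 1 + t * (2 * m + t * d)" for t
  proof -
    have "(norm (P t))\<^sup>2 = ?B \<bullet> ?B + 2 * t * (?B \<bullet> (?A - ?B)) + t * t * ((?A - ?B) \<bullet> (?A - ?B))"
      unfolding P_def power2_norm_eq_inner
      by (simp only: inner_add_left inner_add_right inner_scaleR_left inner_scaleR_right
          inner_commute[of "?A - ?B" ?B]) (simp add: algebra_simps)
    then show ?thesis
      unfolding m BB d_def power2_norm_eq_inner by (simp add: algebra_simps)
  qed
  have P3: "P t $ 3 = 0" for t
    by (simp add: P_def spherical_def)
  have seg: "closed_segment ?A ?B = P ` {0..1}"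
  proof -
    have "P t = (1 - t) *\<^sub>R ?B + t *\<^sub>R ?A" for t
      by (simp add: P_def algebra_simps)
    then show ?thesis
      by (subst closed_segment_commute) (auto simp: closed_segment_def)
  qed
  have PB: "P t = ?B \<longleftrightarrow> t = 0" for t
    using \<open>?A \<noteq> ?B\<close> by (simp add: P_def)
  have disk: "P t \<in> ground_disk \<longleftrightarrow> t * (2 * m + t * d) \<le> 0" for t
    using nP[of t] abs_square_le_1[of "norm (P t)"] by (simp add: ground_disk_def P3)
  have "?B \<in> perimeter"
    by (auto simp: perimeter_def)
  then have "?B \<in> breaching_points ?A \<longleftrightarrow> P ` {0..1} \<inter> ground_disk = {?B}"
    by (simp add: breaching_points_def seg)
  also have "\<dots> \<longleftrightarrow> (\<forall>t\<in>{0..1}. t * (2 * m + t * d) \<le> 0 \<longrightarrow> t = 0)"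
  proof -
    have "?B \<in> P ` {0..1} \<inter> ground_disk"
      using disk[of 0] PB[of 0] by (force simp: image_iff)
    then show ?thesis
      using disk PB by auto
  qed
  also have "\<dots> \<longleftrightarrow> 0 \<le> m"
  proof
    assume *: "\<forall>t\<in>{0..1}. t * (2 * m + t * d) \<le> 0 \<longrightarrow> t = 0"
    show "0 \<le> m"
    proof (rule ccontr)
      assume "\<not> 0 \<le> m"
      define t where "t = min 1 (- m / d)"
      have t: "0 < t" "t \<le> 1" "t * d \<le> - m"
        using \<open>\<not> 0 \<le> m\<close> d by (auto simp: t_def min_def field_simps)
      then have "t * (2 * m + t * d) \<le> 0"
        using \<open>\<not> 0 \<le> m\<close> by (intro mult_nonneg_nonpos) auto
      then show False
        using * t by force
    qed
  next
    assume "0 \<le> m"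
    show "\<forall>t\<in>{0..1}. t * (2 * m + t * d) \<le> 0 \<longrightarrow> t = 0"
    proof (intro ballI impI)
      fix t :: real
      assume t: "t \<in> {0..1}" "t * (2 * m + t * d) \<le> 0"
      show "t = 0"
      proof (rule ccontr)
        assume "t \<noteq> 0"
        then have "0 < t * (2 * m + t * d)"
          using t(1) d \<open>0 \<le> m\<close> by (intro mult_pos_pos add_nonneg_pos) auto
        then show False
          using t(2) by simp
      qed
    qed
  qed
  finally show ?thesis
    by (simp add: m_def)
qed

lemma breaching_iff:
  assumes "r > 1"
  shows "spherical \<theta> 0 1 \<in> breaching_points (spherical \<psi> 0 r) \<longleftrightarrow>
    (\<exists>k::int. \<bar>\<theta> - \<psi> - 2 * pi * of_int k\<bar> \<le> arccos (1 / r))"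
proof -
  have r: "0 < 1 / r" "1 / r < 1"
    using assms by auto
  have le_pi: "arccos (1 / r) \<le> pi"
    using r by (intro arccos_ubound) linarith+
  have cos_iff: "1 / r \<le> cos x \<longleftrightarrow> x \<le> arccos (1 / r)" if "0 \<le> x" "x \<le> pi" for x
    using that r arccos_le_mono[of "cos x" "1 / r"] by (simp add: arccos_cos)
  have shift: "cos (x - 2 * pi * of_int k) = cos x" for x and k :: int
    by (simp add: cos_diff sin_int_2pin cos_int_2pin)
  have "1 \<le> r * cos (\<theta> - \<psi>) \<longleftrightarrow> 1 / r \<le> cos (\<theta> - \<psi>)"
    using assms by (simp add: field_simps)
  also have "\<dots> \<longleftrightarrow> (\<exists>k::int. \<bar>\<theta> - \<psi> - 2 * pi * of_int k\<bar> \<le> arccos (1 / r))"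
  proof
    assume *: "1 / r \<le> cos (\<theta> - \<psi>)"
    define k where "k = round ((\<theta> - \<psi>) / (2 * pi))"
    have "\<bar>of_int k - (\<theta> - \<psi>) / (2 * pi)\<bar> \<le> 1 / 2"
      unfolding k_def by (rule of_int_round_abs_le)
    then have "\<bar>\<theta> - \<psi> - 2 * pi * of_int k\<bar> \<le> pi"
      by (simp add: abs_le_iff field_simps)
    moreover have "1 / r \<le> cos \<bar>\<theta> - \<psi> - 2 * pi * of_int k\<bar>"
      using * shift by simp
    ultimately show "\<exists>k::int. \<bar>\<theta> - \<psi> - 2 * pi * of_int k\<bar> \<le> arccos (1 / r)"
      using cos_iff abs_ge_zero by blast
  next
    assume "\<exists>k::int. \<bar>\<theta> - \<psi> - 2 * pi * of_int k\<bar> \<le> arccos (1 / r)"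
    then obtain k :: int where k: "\<bar>\<theta> - \<psi> - 2 * pi * of_int k\<bar> \<le> arccos (1 / r)"
      by blast
    then have "1 / r \<le> cos \<bar>\<theta> - \<psi> - 2 * pi * of_int k\<bar>"
      using cos_iff le_pi by (meson abs_ge_zero order_trans)
    then show "1 / r \<le> cos (\<theta> - \<psi>)"
      using shift by simp
  qed
  finally show ?thesis
    using breaching_iff_cos[OF assms] by simp
qed

end

theory Submission
  imports Defs
begin

text \<open>
  Seen from the intruder, the distance \<open>h\<close> to the perimeter point at relative azimuth \<open>x\<close> has
  \<open>h' x = cos \<beta>\<close>, so the stationarity condition of the payoff is exactly the claimed formula. At an
  endpoint of the breaching arc the line of sight is tangent, \<open>cos \<beta> = \<plusminus>1\<close>; since the defender time
  is 1-Lipschitz and \<open>\<nu> \<le> 1\<close>, the payoff cannot increase towards the endpoint, and a maximum there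
  is still stationary. The defender time fails to be differentiable only for \<open>\<phi> = 0\<close>, at azimuth
  \<open>0\<close>, a convex kink which is never a maximum, and at azimuth \<open>\<pi>\<close>. If the maximum is at the latter,
  the payoff is concave along the whole arc, because \<open>h\<close> is convex there and the arc is shorter than
  a half turn; hence any stationary point is a maximum as well.
\<close>

section \<open>Distance from the intruder to the perimeter, and its convexity on the breaching
  arc\<close>

definition perimeter_dist :: "real \<Rightarrow> real \<Rightarrow> real" where
  "perimeter_dist r x = sqrt (r\<^sup>2 + 1 - 2 * r * cos x)"

lemma perimeter_dist_radicand_pos:
  fixes r :: real
  assumes "r > 1"
  shows "0 < r\<^sup>2 + 1 - 2 * r * cos x"
proof -
  have "2 * r * cos x \<le> 2 * r"
    using assms by simp
  moreover have "0 < (r - 1)\<^sup>2"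
    using assms by simp
  ultimately show ?thesis
    by (simp add: power2_diff)
qed

lemma perimeter_dist_pos: "r > 1 \<Longrightarrow> 0 < perimeter_dist r x"
  unfolding perimeter_dist_def real_sqrt_gt_0_iff by (rule perimeter_dist_radicand_pos)

lemma perimeter_dist_minus [simp]: "perimeter_dist r (- x) = perimeter_dist r x"
  by (simp add: perimeter_dist_def)

lemma DERIV_perimeter_dist:
  assumes "r > 1"
  shows "(perimeter_dist r has_real_derivative r * sin x / perimeter_dist r x) (at x)"
  unfolding perimeter_dist_def
  using perimeter_dist_radicand_pos[OF assms, of x]
  by (auto intro!: derivative_eq_intros simp: field_simps)

text \<open>The factored form exposes the sign: \<open>r - cos x\<close> is positive, so the
  distance is convex exactly where \<open>r * cos x \<ge> 1\<close>, which is the breaching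
  condition of \<open>breaching_iff_cos\<close>.\<close>

lemma DERIV_perimeter_dist_deriv:
  assumes "r > 1"
  shows "((\<lambda>x. r * sin x / perimeter_dist r x) has_real_derivative
    r * (r * cos x - 1) * (r - cos x) / perimeter_dist r x ^ 3) (at x)"
proof -
  let ?h = "perimeter_dist r x"
  have h: "?h \<noteq> 0" "?h\<^sup>2 = r\<^sup>2 + 1 - 2 * r * cos x"
    using perimeter_dist_pos[OF assms, of x] perimeter_dist_radicand_pos[OF assms, of x]
    by (simp_all add: perimeter_dist_def)
  have "r * cos x * ?h\<^sup>2 - r * sin x * (r * sin x) = r * (r * cos x - 1) * (r - cos x)"
    unfolding h using sin_cos_squared_add[of x] by algebra
  then have "(r * cos x * ?h - r * sin x * (r * sin x / ?h)) / (?h * ?h)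
      = r * (r * cos x - 1) * (r - cos x) / ?h ^ 3"
    using h(1) by (simp add: field_simps power2_eq_square power3_eq_cube)
  moreover have "((\<lambda>x. r * sin x / perimeter_dist r x) has_real_derivative
      (r * cos x * ?h - r * sin x * (r * sin x / ?h)) / (?h * ?h)) (at x)"
    using h(1) by (auto intro!: derivative_eq_intros DERIV_perimeter_dist[OF assms])
  ultimately show ?thesis
    by simp
qed

text \<open>The second derivative is nonnegative on the whole breaching arc. This global bound lets
  a merely stationary point compete with a maximum at the point antipodal to the defender.\<close>

lemma perimeter_dist_above_tangent:
  assumes r: "r > 1" and x: "\<bar>x\<bar> \<le> arccos (1 / r)" and y: "\<bar>y\<bar> \<le> arccos (1 / r)"
  shows "r * sin x / perimeter_dist r x * (y - x) \<le> perimeter_dist r y - perimeter_dist r x"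
proof (rule f''_imp_f'[where C = "{- arccos (1 / r)..arccos (1 / r)}" and
      f'' = "\<lambda>x. r * (r * cos x - 1) * (r - cos x) / perimeter_dist r x ^ 3"])
  fix t
  assume "t \<in> {- arccos (1 / r)..arccos (1 / r)}"
  then have t: "\<bar>t\<bar> \<le> arccos (1 / r)"
    by auto
  have "arccos (1 / r) \<le> pi"
    using r by (intro arccos_ubound) (auto intro: order_trans[of _ 0])
  then have "cos (arccos (1 / r)) \<le> cos \<bar>t\<bar>"
    using t by (intro cos_monotone_0_pi_le) auto
  moreover have "cos (arccos (1 / r)) = 1 / r"
    using r by (intro cos_arccos) (auto intro: order_trans[of _ 0])
  ultimately have "1 \<le> r * cos t"
    using r by (simp add: field_simps)
  moreover have "cos t \<le> r"
    using r cos_le_one[of t] by linarith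
  ultimately show "0 \<le> r * (r * cos t - 1) * (r - cos t) / perimeter_dist r t ^ 3"
    using r perimeter_dist_pos[OF r, of t] by simp
qed (use x y r in \<open>auto intro: DERIV_perimeter_dist DERIV_perimeter_dist_deriv\<close>)

section \<open>Stationarity at a maximum over the breaching arc\<close>

text \<open>If the inequality failed, the objective would increase under a small step towards
  smaller azimuth. Such a step leaves the arc only at its left endpoint, where tangency makes the
  left-hand side -1, already at most \<open>\<nu> * g\<close>. The function \<open>p\<close> is left
  general so that a smooth minorant can replace a defender time with a kink.\<close>

lemma stationary_le_of_arc_max:
  fixes p :: "real \<Rightarrow> real"
  assumes \<nu>: "0 < \<nu>" "\<nu> \<le> 1" and r: "r > 1"
    and p: "(p has_real_derivative g) (at \<theta>)" and g: "\<bar>g\<bar> \<le> 1"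
    and feasible: "1 \<le> r * cos (\<theta> - \<psi>)"
    and max: "\<And>t. 1 \<le> r * cos (t - \<psi>) \<Longrightarrow>
      p t - perimeter_dist r (t - \<psi>) / \<nu> \<le> p \<theta> - perimeter_dist r (\<theta> - \<psi>) / \<nu>"
  shows "r * sin (\<theta> - \<psi>) / perimeter_dist r (\<theta> - \<psi>) \<le> \<nu> * g"
proof (rule ccontr)
  let ?x = "\<theta> - \<psi>"
  let ?F = "\<lambda>t. p t - perimeter_dist r (t - \<psi>) / \<nu>"
  define q where "q = r * sin ?x / perimeter_dist r ?x"
  assume "\<not> r * sin ?x / perimeter_dist r ?x \<le> \<nu> * g"
  then have q: "\<nu> * g < q"
    by (simp add: q_def)
  have "((\<lambda>t. perimeter_dist r (t - \<psi>)) has_real_derivative q) (at \<theta>)"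
    using DERIV_shift[of "perimeter_dist r" q \<theta> "- \<psi>"] DERIV_perimeter_dist[OF r, of ?x]
    by (simp add: q_def)
  then have "(?F has_real_derivative g - q / \<nu>) (at \<theta>)"
    using p \<nu> by (auto intro!: derivative_eq_intros)
  moreover have "g - q / \<nu> < 0"
    using q \<nu> by (simp add: field_simps)
  ultimately obtain d where d: "d > 0" "\<And>e. 0 < e \<Longrightarrow> e < d \<Longrightarrow> ?F \<theta> < ?F (\<theta> - e)"
    using DERIV_neg_dec_left by blast
  have "\<exists>d'>0. \<forall>e. 0 < e \<longrightarrow> e < d' \<longrightarrow> 1 \<le> r * cos (\<theta> - e - \<psi>)"
  \<comment> \<open>For positive sine a step back raises \<open>r * cos\<close>, so even an active
    constraint stays satisfied. Otherwise the constraint must be shown to be strict, and continuity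
    suffices.\<close>
  proof (cases "sin ?x > 0")
    case True
    have "((\<lambda>t. r * cos (t - \<psi>)) has_real_derivative - r * sin ?x) (at \<theta>)"
      by (auto intro!: derivative_eq_intros)
    moreover have "- r * sin ?x < 0"
      using True r by simp
    ultimately obtain d' where "d' > 0"
      "\<And>e. 0 < e \<Longrightarrow> e < d' \<Longrightarrow> r * cos ?x < r * cos (\<theta> - e - \<psi>)"
      using DERIV_neg_dec_left[of "\<lambda>t. r * cos (t - \<psi>)" _ \<theta>] by blast
    then show ?thesis
      using feasible by (meson less_le_trans less_imp_le order_trans)
  next
    case False
    have "r * cos ?x \<noteq> 1"
    proof
      assume c: "r * cos ?x = 1"
      \<comment> \<open>At an endpoint the line of sight is tangent to the circle, so the distance
        is \<open>\<bar>r * sin ?x\<bar>\<close>.\<close>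
      have "(r * sin ?x)\<^sup>2 = r\<^sup>2 + 1 - 2 * r * cos ?x"
        using c sin_cos_squared_add[of ?x] by algebra
      then have "perimeter_dist r ?x = \<bar>r * sin ?x\<bar>"
        unfolding perimeter_dist_def by (metis real_sqrt_abs)
      then have "r * sin ?x = - perimeter_dist r ?x"
        using False r by (simp add: abs_mult)
      then have "q = - 1"
        using perimeter_dist_pos[OF r, of ?x] by (simp add: q_def)
      moreover have "\<bar>\<nu> * g\<bar> \<le> 1"
        using \<nu> g by (simp add: abs_mult mult_le_one)
      ultimately show False
        using q by linarith
    qed
    then have "1 < r * cos ?x"
      using feasible by simp
    moreover have "((\<lambda>t. r * cos (t - \<psi>)) \<longlongrightarrow> r * cos ?x) (at \<theta>)"
      by (intro tendsto_intros)
    ultimately have "\<forall>\<^sub>F t in at \<theta>. 1 < r * cos (t - \<psi>)"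
      by (metis order_tendstoD(1))
    then obtain d' where d': "d' > 0"
      "\<And>t. t \<noteq> \<theta> \<Longrightarrow> dist t \<theta> < d' \<Longrightarrow> 1 < r * cos (t - \<psi>)"
      by (auto simp: eventually_at)
    have "1 \<le> r * cos (\<theta> - e - \<psi>)" if "0 < e" "e < d'" for e
      using d'(2)[of "\<theta> - e"] that by (simp add: dist_real_def)
    then show ?thesis
      using d'(1) by blast
  qed
  then obtain d' where d': "d' > 0" "\<And>e. 0 < e \<Longrightarrow> e < d' \<Longrightarrow> 1 \<le> r * cos (\<theta> - e - \<psi>)"
    by blast
  define e where "e = min d d' / 2"
  have "0 < e" "e < d" "e < d'"
    using d(1) d'(1) by (auto simp: e_def min_def)
  then show False
    using d(2)[of e] max[OF d'(2)[of e]] by simp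
qed

text \<open>The reverse inequality is the one-sided lemma applied to the mirror image, with
  \<open>t\<close>, \<theta> and \<psi> negated; this flips the signs of both the sine and
  \<open>g\<close>.\<close>

lemma stationary_of_arc_max:
  fixes p :: "real \<Rightarrow> real"
  assumes \<nu>: "0 < \<nu>" "\<nu> \<le> 1" and r: "r > 1"
    and p: "(p has_real_derivative g) (at \<theta>)" and g: "\<bar>g\<bar> \<le> 1"
    and feasible: "1 \<le> r * cos (\<theta> - \<psi>)"
    and max: "\<And>t. 1 \<le> r * cos (t - \<psi>) \<Longrightarrow>
      p t - perimeter_dist r (t - \<psi>) / \<nu> \<le> p \<theta> - perimeter_dist r (\<theta> - \<psi>) / \<nu>"
  shows "r * sin (\<theta> - \<psi>) / perimeter_dist r (\<theta> - \<psi>) = \<nu> * g"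
proof (rule antisym)
  show "r * sin (\<theta> - \<psi>) / perimeter_dist r (\<theta> - \<psi>) \<le> \<nu> * g"
    by (rule stationary_le_of_arc_max[OF assms])
  have flip: "cos (- t + \<psi>) = cos (t - \<psi>)" "sin (- t + \<psi>) = - sin (t - \<psi>)"
    "perimeter_dist r (- t + \<psi>) = perimeter_dist r (t - \<psi>)" for t
    using cos_minus[of "t - \<psi>"] sin_minus[of "t - \<psi>"] perimeter_dist_minus[of r "t - \<psi>"]
    by simp_all
  have p': "((\<lambda>t. p (- t)) has_real_derivative - g) (at (- \<theta>))"
    using DERIV_mirror[of p g "- \<theta>"] p by simp
  have max': "p (- t) - perimeter_dist r (t - (- \<psi>)) / \<nu>
      \<le> p (- (- \<theta>)) - perimeter_dist r (- \<theta> - (- \<psi>)) / \<nu>"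
    if "1 \<le> r * cos (t - (- \<psi>))" for t
    using max[of "- t"] that flip[of "- t"] flip[of \<theta>] by simp
  have "r * sin (- \<theta> - (- \<psi>)) / perimeter_dist r (- \<theta> - (- \<psi>)) \<le> \<nu> * - g"
    using g feasible flip[of \<theta>] by (intro stationary_le_of_arc_max[OF \<nu> r p' _ _ max']) auto
  then show "\<nu> * g \<le> r * sin (\<theta> - \<psi>) / perimeter_dist r (\<theta> - \<psi>)"
    using flip[of \<theta>] by simp
qed

section \<open>From breaching points to azimuths, and existence of a maximum\<close>

lemma spherical_representative: "\<exists>t\<in>{0..2 * pi}. spherical t 0 1 = spherical \<theta> 0 1"
proof -
  obtain t where "0 \<le> t" "t < 2 * pi" "cos \<theta> = cos t" "sin \<theta> = sin t"
    using sincos_total_2pi[of "cos \<theta>" "sin \<theta>"] by auto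
  then show ?thesis
    by (intro bexI[of _ t]) (auto simp: spherical_def)
qed

lemma perimeter_representative:
  assumes "z \<in> breaching_points zA"
  obtains t where "z = spherical t 0 1"
  using assms by (auto simp: breaching_points_def perimeter_def)

lemma payoff_spherical:
  "payoff \<nu> (spherical 0 \<phi> 1) (spherical \<psi> 0 r) (spherical \<theta> 0 1)
    = arccos (cos \<phi> * cos \<theta>) - perimeter_dist r (\<theta> - \<psi>) / \<nu>"
  by (simp add: payoff_def defender_time_spherical intruder_time_spherical perimeter_dist_def)

lemma approach_angle_spherical:
  "approach_angle (spherical \<psi> 0 r) (spherical \<theta> 0 1)
    = arccos (r * sin (\<theta> - \<psi>) / perimeter_dist r (\<theta> - \<psi>))"
proof -
  \<comment> \<open>Cauchy-Schwarz keeps the argument of \<open>arccos\<close> within its domain;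
    for a zero vector the quotient is 0 by convention.\<close>
  have "\<bar>(u \<bullet> v) / (norm u * norm v)\<bar> \<le> 1" for u v :: "real ^ 3"
    using Cauchy_Schwarz_ineq2[of u v] by (auto simp: abs_mult divide_le_eq_1 zero_less_mult_iff)
  then have "arccos (cos (approach_angle (spherical \<psi> 0 r) (spherical \<theta> 0 1)))
      = approach_angle (spherical \<psi> 0 r) (spherical \<theta> 0 1)"
    by (simp add: approach_angle_def vec_angle_def cos_arccos_abs)
  then show ?thesis
    by (simp add: cos_approach_angle norm_intruder_breach perimeter_dist_def)
qed

lemma is_arg_max_spherical_iff:
  assumes "r > 1"
  shows "is_arg_max (payoff \<nu> (spherical 0 \<phi> 1) (spherical \<psi> 0 r))
      (\<lambda>z. z \<in> breaching_points (spherical \<psi> 0 r)) (spherical \<theta> 0 1) \<longleftrightarrow>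
    1 \<le> r * cos (\<theta> - \<psi>) \<and>
    (\<forall>t. 1 \<le> r * cos (t - \<psi>) \<longrightarrow>
      arccos (cos \<phi> * cos t) - perimeter_dist r (t - \<psi>) / \<nu>
      \<le> arccos (cos \<phi> * cos \<theta>) - perimeter_dist r (\<theta> - \<psi>) / \<nu>)"
  unfolding is_arg_max_def
  by (metis breaching_iff_cos[OF assms] payoff_spherical perimeter_representative not_le)

text \<open>The payoff depends only on the point, not on its azimuth, so it suffices to maximize a
  continuous function over the feasible azimuths of one full turn, a compact set containing a
  representative of \<psi>.\<close>

lemma exists_arg_max:
  assumes "r > 1"
  shows "\<exists>\<theta>. is_arg_max (payoff \<nu> (spherical 0 \<phi> 1) (spherical \<psi> 0 r))
    (\<lambda>z. z \<in> breaching_points (spherical \<psi> 0 r)) (spherical \<theta> 0 1)"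
proof -
  let ?zA = "spherical \<psi> 0 r"
  let ?S = "{0..2 * pi} \<inter> {t. 1 \<le> r * cos (t - \<psi>)}"
  let ?F = "\<lambda>t. arccos (cos \<phi> * cos t) - perimeter_dist r (t - \<psi>) / \<nu>"
  have "compact ?S"
    by (intro compact_Int_closed closed_Collect_le continuous_intros) auto
  moreover have "?S \<noteq> {}"
  proof -
    obtain t where "t \<in> {0..2 * pi}" "spherical t 0 1 = spherical \<psi> 0 1"
      using spherical_representative by blast
    moreover have "spherical \<psi> 0 1 \<in> breaching_points ?zA"
      using assms by (simp add: breaching_iff_cos)
    ultimately show ?thesis
      using breaching_iff_cos[OF assms, of t \<psi>] by auto
  qed
  moreover have "continuous_on ?S ?F"
  proof -
    have "\<bar>cos \<phi> * cos t\<bar> \<le> 1" for t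
      by (simp add: abs_mult mult_le_one)
    then have "- 1 \<le> cos \<phi> * cos t \<and> cos \<phi> * cos t \<le> 1" for t
      by (metis abs_le_iff minus_le_iff)
    then show ?thesis
      unfolding perimeter_dist_def divide_inverse by (intro continuous_intros) auto
  qed
  ultimately obtain \<theta> where \<theta>: "\<theta> \<in> ?S" "\<And>t. t \<in> ?S \<Longrightarrow> ?F t \<le> ?F \<theta>"
    using continuous_attains_sup by meson
  have "?F t \<le> ?F \<theta>" if t: "1 \<le> r * cos (t - \<psi>)" for t
  proof -
    obtain s where s: "s \<in> {0..2 * pi}" "spherical s 0 1 = spherical t 0 1"
      using spherical_representative by blast
    then have "s \<in> ?S"
      using t breaching_iff_cos[OF assms, of _ \<psi>] by (metis IntI mem_Collect_eq)
    then show ?thesis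
      using \<theta>(2)[of s] s(2) by (metis payoff_spherical)
  qed
  then show ?thesis
    using \<theta>(1) is_arg_max_spherical_iff[OF assms] by blast
qed

section \<open>Maximizers and the approach-angle formula\<close>

lemma abs_sin_le_arccos_cos: "\<bar>sin t\<bar> \<le> arccos (cos t)" for t :: real
proof -
  have "\<bar>sin t\<bar> = sin (arccos (cos t))"
    by (simp add: sin_arccos sin_squared_eq[symmetric])
  also have "\<dots> \<le> arccos (cos t)"
    by (intro sin_x_le_x arccos_lbound) auto
  finally show ?thesis .
qed

lemma optimal_approach_if_arg_max:
  assumes \<nu>: "0 < \<nu>" "\<nu> \<le> 1" and \<phi>: "0 \<le> \<phi>" "\<phi> \<le> pi / 2" and r: "r > 1"
    and argmax: "is_arg_max (payoff \<nu> (spherical 0 \<phi> 1) (spherical \<psi> 0 r))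
      (\<lambda>z. z \<in> breaching_points (spherical \<psi> 0 r)) (spherical \<theta> 0 1)"
    and nonsingular: "\<not> (\<phi> = 0 \<and> cos \<theta> = - 1)"
  shows "optimal_approach \<nu> \<phi> (spherical \<psi> 0 r) \<theta>"
proof -
  define c where "c = cos \<phi>"
  have feasible: "1 \<le> r * cos (\<theta> - \<psi>)"
    and max: "\<And>t. 1 \<le> r * cos (t - \<psi>) \<Longrightarrow>
      arccos (c * cos t) - perimeter_dist r (t - \<psi>) / \<nu>
      \<le> arccos (c * cos \<theta>) - perimeter_dist r (\<theta> - \<psi>) / \<nu>"
    using argmax is_arg_max_spherical_iff[OF r] by (auto simp: c_def)
  have c: "0 \<le> c" "c \<le> 1"
    using \<phi> by (auto simp: c_def intro!: cos_ge_zero)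
  \<comment> \<open>Equality would mean \<phi> = 0 and \<open>cos \<theta> = \<plusminus>1\<close>.
    The value -1 is excluded by \<open>nonsingular\<close>, which leaves the convex kink at azimuth
    0.\<close>
  have lt: "\<bar>c * cos \<theta>\<bar> < 1"
  proof (rule ccontr)
    assume "\<not> \<bar>c * cos \<theta>\<bar> < 1"
    moreover have "\<bar>c * cos \<theta>\<bar> \<le> c" "\<bar>c * cos \<theta>\<bar> \<le> \<bar>cos \<theta>\<bar>"
      using c by (simp_all add: abs_mult mult_left_le mult_left_le_one_le)
    ultimately have "c = 1" "\<bar>cos \<theta>\<bar> = 1"
      using c abs_cos_le_one[of \<theta>] by linarith+
    then have "\<phi> = 0"
      using \<phi> cos_inj_pi[of \<phi> 0] by (simp add: c_def)
    then have "cos \<theta> = 1"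
      using nonsingular \<open>\<bar>cos \<theta>\<bar> = 1\<close> by auto
    have sin0: "sin \<theta> = 0"
      using \<open>cos \<theta> = 1\<close> by (simp add: cos_one_sin_zero)
    \<comment> \<open>Both \<open>sin\<close> and \<open>- sin\<close> lie below the defender time and touch it at \<open>\<theta>\<close>.\<close>
    have "r * sin (\<theta> - \<psi>) / perimeter_dist r (\<theta> - \<psi>) = \<nu> * s" if s: "\<bar>s\<bar> = 1" for s
    proof (rule stationary_of_arc_max[OF \<nu> r _ _ feasible])
      show "((\<lambda>t. s * sin t) has_real_derivative s) (at \<theta>)"
        using \<open>cos \<theta> = 1\<close> by (auto intro!: derivative_eq_intros)
      show "\<bar>s\<bar> \<le> 1"
        using s by simp
      fix t
      assume t: "1 \<le> r * cos (t - \<psi>)"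
      have "s * sin t \<le> \<bar>s * sin t\<bar>"
        by simp
      also have "\<dots> \<le> arccos (cos t)"
        using abs_sin_le_arccos_cos[of t] s by (simp add: abs_mult)
      finally show "s * sin t - perimeter_dist r (t - \<psi>) / \<nu>
          \<le> s * sin \<theta> - perimeter_dist r (\<theta> - \<psi>) / \<nu>"
        using max[OF t] by (simp add: \<open>c = 1\<close> \<open>cos \<theta> = 1\<close> sin0)
    qed
    \<comment> \<open>The two minorants have opposite slopes at the kink, so stationarity for both
      would give \<nu> = -\<nu>.\<close>
    from this[of 1] this[of "- 1"] show False
      using \<nu> by simp
  qed
  define w where "w = sqrt (1 - c\<^sup>2 * (cos \<theta>)\<^sup>2)"
  have rad: "0 < 1 - c\<^sup>2 * (cos \<theta>)\<^sup>2"
    using lt by (simp add: abs_square_less_1 flip: power_mult_distrib)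
  then have w: "w > 0"
    by (simp add: w_def)
  have "((\<lambda>t. arccos (c * cos t)) has_real_derivative c * sin \<theta> / w) (at \<theta>)"
    using lt w unfolding w_def
    by (auto intro!: derivative_eq_intros simp: power_mult_distrib field_simps)
  \<comment> \<open>The 1-Lipschitz bound on the defender time, needed at the endpoints of the arc;
    it reduces to \<open>c\<^sup>2 \<le> 1\<close>.\<close>
  moreover have "\<bar>c * sin \<theta> / w\<bar> \<le> 1"
  proof -
    have "(c * sin \<theta>)\<^sup>2 = c\<^sup>2 - c\<^sup>2 * (cos \<theta>)\<^sup>2"
      using sin_cos_squared_add[of \<theta>] by algebra
    also have "\<dots> \<le> w\<^sup>2"
      using c rad by (simp add: w_def power_le_one)
    finally have "\<bar>c * sin \<theta>\<bar> \<le> w"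
      using w by (metis abs_le_square_iff abs_of_pos)
    then show ?thesis
      using w by (simp add: abs_divide)
  qed
  ultimately have "r * sin (\<theta> - \<psi>) / perimeter_dist r (\<theta> - \<psi>) = \<nu> * (c * sin \<theta> / w)"
    using feasible max by (rule stationary_of_arc_max[OF \<nu> r])
  then show ?thesis
    using w by (simp add: optimal_approach_def approach_angle_spherical w_def c_def)
qed

text \<open>Here \<open>m\<close> is the azimuth antipodal to a defender on the ground. Moving from
  \<open>m\<close> to a stationary \<theta> costs the turning angle in defender time, but by the
  tangent inequality at \<theta> saves at least as much intruder time.\<close>

lemma singular_max_le_stationary:
  assumes \<nu>: "0 < \<nu>" "\<nu> \<le> 1" and r: "r > 1"
    and m: "spherical m 0 1 \<in> breaching_points (spherical \<psi> 0 r)" "cos m = - 1"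
    and \<theta>: "spherical \<theta> 0 1 \<in> breaching_points (spherical \<psi> 0 r)"
    and opt: "optimal_approach \<nu> 0 (spherical \<psi> 0 r) \<theta>"
  shows "payoff \<nu> (spherical 0 0 1) (spherical \<psi> 0 r) (spherical m 0 1)
    \<le> payoff \<nu> (spherical 0 0 1) (spherical \<psi> 0 r) (spherical \<theta> 0 1)"
proof -
  obtain j k :: int
    where j: "\<bar>m - \<psi> - 2 * pi * of_int j\<bar> \<le> arccos (1 / r)"
      and k: "\<bar>\<theta> - \<psi> - 2 * pi * of_int k\<bar> \<le> arccos (1 / r)"
    using m(1) \<theta> breaching_iff[OF r] by meson
  \<comment> \<open>Both azimuths relative to the intruder are lifted to the same interval, so that
    \<delta> is the signed turn from \<open>m\<close> to \<theta> along the arc.\<close>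
  define a where "a = m - \<psi> - 2 * pi * of_int j"
  define b where "b = \<theta> - \<psi> - 2 * pi * of_int k"
  define \<delta> where "\<delta> = b - a"
  have shift: "cos (x - 2 * pi * of_int i) = cos x" "sin (x - 2 * pi * of_int i) = sin x"
    for x and i :: int
    by (simp_all add: cos_diff sin_diff sin_int_2pin cos_int_2pin)
  \<comment> \<open>The arc is shorter than a half turn, so \<open>sin \<delta>\<close> has the sign
    of \<delta> and the defender time at \<theta> is
    \<open>pi - \<bar>\<delta>\<bar>\<close>.\<close>
  have "arccos (1 / r) < pi / 2"
    using r arccos_less_arccos[of 0 "1 / r"] by simp
  then have \<delta>: "\<bar>\<delta>\<bar> < pi"
    using j k unfolding \<delta>_def a_def b_def by linarith
  have sin_m: "sin m = 0"
    using m(2) sin_cos_squared_add[of m] by simp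
  have "\<theta> = m + \<delta> - 2 * pi * of_int (j - k)"
    by (simp add: \<delta>_def a_def b_def algebra_simps)
  then have trig: "cos \<theta> = - cos \<delta>" "sin \<theta> = - sin \<delta>"
    by (simp_all only: shift) (simp_all add: cos_add sin_add m(2) sin_m)
  have root: "sqrt (1 - (cos \<theta>)\<^sup>2) = \<bar>sin \<delta>\<bar>"
    using trig(1) by (simp add: sin_squared_eq[symmetric])
  \<comment> \<open>The nonzero denominator in \<open>optimal_approach\<close> rules out that
    \<theta> and \<open>m\<close> give the same point.\<close>
  then have "sin \<delta> \<noteq> 0"
    using opt by (auto simp: optimal_approach_def)
  have sgn: "sin \<theta> / \<bar>sin \<delta>\<bar> = - sgn \<delta>"
  proof (cases "\<delta> > 0")
    case True
    then have "sin \<delta> > 0"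
      using \<delta> by (intro sin_gt_zero) auto
    then show ?thesis
      using True by (simp add: trig)
  next
    case False
    then have "\<delta> < 0"
      using \<open>sin \<delta> \<noteq> 0\<close> by (cases "\<delta> = 0") auto
    then have "sin (- \<delta>) > 0"
      using \<delta> by (intro sin_gt_zero) auto
    then show ?thesis
      using \<open>\<delta> < 0\<close> by (simp add: trig)
  qed
  have "cos (approach_angle (spherical \<psi> 0 r) (spherical \<theta> 0 1)) = cos (arccos (\<nu> * - sgn \<delta>))"
    using opt by (simp add: optimal_approach_def root sgn)
  also have "\<dots> = \<nu> * - sgn \<delta>"
    using \<nu> by (intro cos_arccos_abs) (auto simp: sgn_if)
  finally have "r * sin b / perimeter_dist r b = - \<nu> * sgn \<delta>"
    by (simp add: cos_approach_angle norm_intruder_breach perimeter_dist_def b_def shift)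
  then have "- \<nu> * sgn \<delta> * (a - b) \<le> perimeter_dist r a - perimeter_dist r b"
    using perimeter_dist_above_tangent[OF r, of b a] j k by (simp add: a_def b_def)
  moreover have "- \<nu> * sgn \<delta> * (a - b) = \<nu> * \<bar>\<delta>\<bar>"
    by (simp add: \<delta>_def sgn_if abs_if algebra_simps)
  ultimately have "\<bar>\<delta>\<bar> \<le> perimeter_dist r a / \<nu> - perimeter_dist r b / \<nu>"
    using \<nu> by (simp add: field_simps)
  moreover have "arccos (cos \<theta>) = pi - \<bar>\<delta>\<bar>"
    using \<delta> arccos_cos[of "\<bar>\<delta>\<bar>"] by (simp add: trig arccos_minus)
  moreover have "perimeter_dist r a = perimeter_dist r (m - \<psi>)"
    "perimeter_dist r b = perimeter_dist r (\<theta> - \<psi>)"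
    by (simp_all add: perimeter_dist_def a_def b_def shift)
  ultimately show ?thesis
    by (simp add: payoff_spherical m(2))
qed

theorem theorem1:
  fixes \<nu> \<phi>\<^sub>D \<psi> r :: real and zD zA :: "real ^ 3"
  assumes "0 < \<nu>" and "\<nu> \<le> 1"
    and "0 \<le> \<phi>\<^sub>D" and "\<phi>\<^sub>D \<le> pi / 2"
    and "r > 1"
    and "zD = spherical 0 \<phi>\<^sub>D 1" and "zA = spherical \<psi> 0 r"
  shows
    "(\<exists>\<theta>. is_arg_max (payoff \<nu> zD zA) (\<lambda>z. z \<in> breaching_points zA) (spherical \<theta> 0 1)) \<and>
     (\<forall>\<theta>. is_arg_max (payoff \<nu> zD zA) (\<lambda>z. z \<in> breaching_points zA) (spherical \<theta> 0 1) \<longrightarrow>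
        \<not> (\<phi>\<^sub>D = 0 \<and> cos \<theta> = -1) \<longrightarrow>
        optimal_approach \<nu> \<phi>\<^sub>D zA \<theta>) \<and>
     (\<forall>\<theta>. spherical \<theta> 0 1 \<in> breaching_points zA \<and> optimal_approach \<nu> \<phi>\<^sub>D zA \<theta> \<and>
        (\<forall>\<theta>'. spherical \<theta>' 0 1 \<in> breaching_points zA \<and> optimal_approach \<nu> \<phi>\<^sub>D zA \<theta>' \<longrightarrow>
           payoff \<nu> zD zA (spherical \<theta>' 0 1) \<le> payoff \<nu> zD zA (spherical \<theta> 0 1)) \<longrightarrow>
        is_arg_max (payoff \<nu> zD zA) (\<lambda>z. z \<in> breaching_points zA) (spherical \<theta> 0 1))"
proof -
  let ?max = "\<lambda>\<theta>. is_arg_max (payoff \<nu> zD zA) (\<lambda>z. z \<in> breaching_points zA) (spherical \<theta> 0 1)"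
  obtain m where m: "?max m"
    using exists_arg_max[OF \<open>r > 1\<close>] assms(6,7) by blast
  have opt: "optimal_approach \<nu> \<phi>\<^sub>D zA \<theta>" if "?max \<theta>" "\<not> (\<phi>\<^sub>D = 0 \<and> cos \<theta> = -1)" for \<theta>
    using that unfolding assms(6,7) by (intro optimal_approach_if_arg_max[OF assms(1-5)]) auto
  have m_in: "spherical m 0 1 \<in> breaching_points zA"
    using m by (simp add: is_arg_max_def)
  have "?max \<theta>"
    if \<theta>: "spherical \<theta> 0 1 \<in> breaching_points zA" "optimal_approach \<nu> \<phi>\<^sub>D zA \<theta>"
      and best: "\<And>\<theta>'. spherical \<theta>' 0 1 \<in> breaching_points zA \<Longrightarrow> optimal_approach \<nu> \<phi>\<^sub>D zA \<theta>' \<Longrightarrow>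
        payoff \<nu> zD zA (spherical \<theta>' 0 1) \<le> payoff \<nu> zD zA (spherical \<theta> 0 1)" for \<theta>
  proof -
    \<comment> \<open>It suffices to match one known maximizer \<open>m\<close>. Unless
      \<open>m\<close> is singular, it satisfies the formula itself and so is among the competitors
      in \<open>best\<close>.\<close>
    have "payoff \<nu> zD zA (spherical m 0 1) \<le> payoff \<nu> zD zA (spherical \<theta> 0 1)"
    proof (cases "\<phi>\<^sub>D = 0 \<and> cos m = -1")
      case True
      then show ?thesis
        using singular_max_le_stationary[OF assms(1,2,5)] m_in \<theta> assms(6,7) by auto
    next
      case False
      then show ?thesis
        using best[OF m_in opt[OF m]] by blast
    qed
    then show ?thesis
      using m \<theta>(1) unfolding is_arg_max_def by (meson le_less_trans not_le)
  qed
  then show ?thesis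
    using m opt by blast
qed

end
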